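(* Let $n\ge 3$ and $d\ge 2$ be integers, and let $t_{\mathrm{mix}}$ and $\hat t_{\mathrm{mix}}$ be the mixing times of the Rook's Walk and of the Rook's Walk Birth-Death (RWBD) chain respectively, each with parameters $n,d$. Then $t_{\mathrm{mix}}(\epsilon)=\hat t_{\mathrm{mix}}(\epsilon)$ for all $\epsilon\in(0,1)$.
   Context: The Rook's Walk with parameters $n,d$ is the discrete-time Markov chain on $\Omega=\{1,\dots,n\}^d$ with transition matrix $P(x,y)=\frac{1}{d(n-1)}$ if $\|x-y\|_0=1$ and $0$ otherwise, where $\|\cdot\|_0$ denotes Hamming distance; its stationary distribution is uniform on $\Omega$. Let $\hat 1=(1,\dots,1)$ and let $H_i=\{x\in\Omega:\|\hat 1-x\|_0=i\}$ be the $i$-th Hamming shell, $0\le i\le d$. The RWBD chain with parameters $n,d$ is the Markov chain on $\Omega_*=\{0,\dots,d\}$ which moves from $x$ to $y$ with probability $\mathbb{P}[Y_1\in H_y\mid Y_0\in H_x]$, where $Y_1$ is obtained from $Y_0$ by one step of the Rook's Walk; explicitly, from $x$ it stays at $x$ with probability $\frac{x(n-2)}{d(n-1)}$, moves to $x-1$ with probability $\frac{x}{d(n-1)}$, and moves to $x+1$ with probability $\frac{d-x}{d}$. Its stationary distribution is $\pi_*(x)=\binom{d}{x}(n-1)^x n^{-d}$. For a chain with transition matrix $Q$ on a finite state space $S$ and stationary distribution $\sigma$, the mixing time at $\epsilon$ is $\inf\{t\in\mathbb{Z}_{\ge0}:\max_{x\in S}\|Q^t(x,\cdot)-\sigma\|_{TV}\le\epsilon\}$,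 where $Q^t(x,\cdot)$ is the law at time $t$ started from $x$ and $\|\mu-\nu\|_{TV}=\frac12\sum_{x}|\mu(x)-\nu(x)|$. *)

theory Defs
  imports Complex_Main "HOL-Library.FuncSet" "HOL-Library.Extended_Nat"
begin

primrec chain_law :: "'s set \<Rightarrow> ('s \<Rightarrow> 's \<Rightarrow> real) \<Rightarrow> nat \<Rightarrow> 's \<Rightarrow> 's \<Rightarrow> real" where
  "chain_law S Q 0 x y = (if x = y then 1 else 0)"
| "chain_law S Q (Suc t) x y = (\<Sum>z\<in>S. chain_law S Q t x z * Q z y)"

definition stochastic_on :: "'s set \<Rightarrow> ('s \<Rightarrow> 's \<Rightarrow> real) \<Rightarrow> bool" where
  "stochastic_on S Q \<longleftrightarrow>
     (\<forall>x\<in>S. (\<forall>y\<in>S. 0 \<le> Q x y) \<and> (\<Sum>y\<in>S. Q x y) = 1)"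

definition stationary_on :: "'s set \<Rightarrow> ('s \<Rightarrow> 's \<Rightarrow> real) \<Rightarrow> ('s \<Rightarrow> real) \<Rightarrow> bool" where
  "stationary_on S Q \<sigma> \<longleftrightarrow>
     (\<forall>x\<in>S. 0 \<le> \<sigma> x) \<and> (\<Sum>x\<in>S. \<sigma> x) = 1 \<and> (\<forall>y\<in>S. (\<Sum>x\<in>S. \<sigma> x * Q x y) = \<sigma> y)"

definition tv_dist :: "'s set \<Rightarrow> ('s \<Rightarrow> real) \<Rightarrow> ('s \<Rightarrow> real) \<Rightarrow> real" where
  "tv_dist S \<mu> \<nu> = (1/2) * (\<Sum>x\<in>S. \<bar>\<mu> x - \<nu> x\<bar>)"

(* The infimum is taken in the extended naturals, so that a chain that never comes within
   \<epsilon> of \<sigma> has mixing time \<infinity> (an infimum over nat would give 0). *)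
definition mixing_time ::
    "'s set \<Rightarrow> ('s \<Rightarrow> 's \<Rightarrow> real) \<Rightarrow> ('s \<Rightarrow> real) \<Rightarrow> real \<Rightarrow> enat" where
  "mixing_time S Q \<sigma> \<epsilon> =
     Inf (enat ` {t. Max ((\<lambda>x. tv_dist S (chain_law S Q t x) \<sigma>) ` S) \<le> \<epsilon>})"

(* Points of {1..n}^d are extensional functions on {1..d}. *)
definition rook_states :: "nat \<Rightarrow> nat \<Rightarrow> (nat \<Rightarrow> nat) set" where
  "rook_states n d = ({1..d} \<rightarrow>\<^sub>E {1..n})"

definition hamming :: "nat \<Rightarrow> (nat \<Rightarrow> nat) \<Rightarrow> (nat \<Rightarrow> nat) \<Rightarrow> nat" where
  "hamming d x y = card {i\<in>{1..d}. x i \<noteq> y i}"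

definition rook_P :: "nat \<Rightarrow> nat \<Rightarrow> (nat \<Rightarrow> nat) \<Rightarrow> (nat \<Rightarrow> nat) \<Rightarrow> real" where
  "rook_P n d x y = (if hamming d x y = 1 then 1 / (real d * (real n - 1)) else 0)"

definition rook_stat :: "nat \<Rightarrow> nat \<Rightarrow> (nat \<Rightarrow> nat) \<Rightarrow> real" where
  "rook_stat n d x = 1 / real (card (rook_states n d))"

definition rook_tmix :: "nat \<Rightarrow> nat \<Rightarrow> real \<Rightarrow> enat" where
  "rook_tmix n d = mixing_time (rook_states n d) (rook_P n d) (rook_stat n d)"

definition ones :: "nat \<Rightarrow> nat \<Rightarrow> nat" where
  "ones d = (\<lambda>i\<in>{1..d}. 1)"

definition shell :: "nat \<Rightarrow> nat \<Rightarrow> nat \<Rightarrow> (nat \<Rightarrow> nat) set" where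
  "shell n d i = {x \<in> rook_states n d. hamming d (ones d) x = i}"

definition rwbd_states :: "nat \<Rightarrow> nat set" where
  "rwbd_states d = {0..d}"

(* P[Y_1 in H_j | Y_0 in H_i] with Y_0 stationary.  The choice of the law of Y_0 is immaterial:
   by rook_P_shell below the probability of stepping into H_j is the same from every point of
   H_i.  Lemma rwbd_P_explicit gives the values. *)
definition rwbd_P :: "nat \<Rightarrow> nat \<Rightarrow> nat \<Rightarrow> nat \<Rightarrow> real" where
  "rwbd_P n d i j =
     (\<Sum>u\<in>shell n d i. \<Sum>v\<in>shell n d j. rook_stat n d u * rook_P n d u v) /
     (\<Sum>u\<in>shell n d i. rook_stat n d u)"

definition rwbd_stat :: "nat \<Rightarrow> nat \<Rightarrow> nat \<Rightarrow> real" where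
  "rwbd_stat n d i = real (d choose i) * (real n - 1) ^ i / real n ^ d"

definition rwbd_tmix :: "nat \<Rightarrow> nat \<Rightarrow> real \<Rightarrow> enat" where
  "rwbd_tmix n d = mixing_time (rwbd_states d) (rwbd_P n d) (rwbd_stat n d)"


lemma finite_rook_states [simp]: "finite (rook_states n d)"
  by (simp add: rook_states_def finite_PiE)

lemma finite_shell [simp]: "finite (shell n d i)"
  by (simp add: shell_def)

lemma hamming_commute: "hamming d x y = hamming d y x"
  unfolding hamming_def by (rule arg_cong[of _ _ card]) auto

lemma hamming_ones: "hamming d (ones d) x = card {i\<in>{1..d}. x i \<noteq> 1}"
  unfolding hamming_def ones_def by (rule arg_cong[of _ _ card]) auto

lemma hamming_le: "hamming d x y \<le> d"
proof -
  have "card {i\<in>{1..d}. x i \<noteq> y i} \<le> card {1..d}" by (rule card_mono) auto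
  then show ?thesis by (simp add: hamming_def)
qed

lemma card_rook_states: "card (rook_states n d) = n ^ d"
  by (simp add: rook_states_def card_PiE)

lemma rook_states_eq_Union_shell: "rook_states n d = (\<Union>i\<in>{0..d}. shell n d i)"
  using hamming_le by (auto simp: shell_def)

lemma sum_over_shells:
  "(\<Sum>i=0..d. \<Sum>u\<in>shell n d i. f u) = (\<Sum>u\<in>rook_states n d. f u)"
  unfolding rook_states_eq_Union_shell
  by (rule sum.UNION_disjoint[symmetric]) (auto simp: shell_def)

lemma card_shell:
  assumes "n \<ge> 1"
  shows "card (shell n d i) = (d choose i) * (n - 1) ^ i"
proof -
  define B where "B = (\<lambda>T. PiE {1..d} (\<lambda>k. if k \<in> T then {2..n} else {1}))"
  define Ts where "Ts = {T. T \<subseteq> {1..d} \<and> card T = i}"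
  have supp: "{k\<in>{1..d}. x k \<noteq> 1} = T" if "x \<in> B T" "T \<in> Ts" for x T
  proof -
    have *: "(x k \<noteq> 1) = (k \<in> T)" if "k \<in> {1..d}" for k
    proof -
      have "x k \<in> (if k \<in> T then {2..n} else {1})"
        using \<open>x \<in> B T\<close> that unfolding B_def by (rule PiE_mem)
      then show ?thesis by (auto split: if_splits)
    qed
    have "T \<subseteq> {1..d}" using that(2) by (simp add: Ts_def)
    then show ?thesis using * by blast
  qed
  have "shell n d i = (\<Union>T\<in>Ts. B T)"
  proof (intro equalityI subsetI)
    fix x assume x: "x \<in> shell n d i"
    let ?T = "{k\<in>{1..d}. x k \<noteq> 1}"
    have xS: "x \<in> {1..d} \<rightarrow>\<^sub>E {1..n}" using x by (simp add: shell_def rook_states_def)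
    have "?T \<in> Ts" using x by (auto simp: Ts_def shell_def hamming_ones)
    moreover have "x \<in> B ?T" unfolding B_def
    proof (rule PiE_I)
      fix k assume k: "k \<in> {1..d}"
      have "x k \<in> {1..n}" using xS k by (rule PiE_mem)
      then show "x k \<in> (if k \<in> ?T then {2..n} else {1})" using k by auto
    next
      fix k assume "k \<notin> {1..d}"
      then show "x k = undefined" using xS by (rule PiE_arb[rotated])
    qed
    ultimately show "x \<in> (\<Union>T\<in>Ts. B T)" by blast
  next
    fix x assume "x \<in> (\<Union>T\<in>Ts. B T)"
    then obtain T where T: "T \<in> Ts" "x \<in> B T" by blast
    have "B T \<subseteq> {1..d} \<rightarrow>\<^sub>E {1..n}"
      unfolding B_def using assms by (intro PiE_mono) auto
    then show "x \<in> shell n d i"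
      using T supp[OF T(2,1)] by (auto simp: shell_def rook_states_def hamming_ones Ts_def)
  qed
  also have "card \<dots> = (\<Sum>T\<in>Ts. card (B T))"
  proof (rule card_UN_disjoint)
    show "finite Ts" by (simp add: Ts_def)
    show "\<forall>T\<in>Ts. finite (B T)" by (auto simp: B_def intro!: finite_PiE)
    show "\<forall>T\<in>Ts. \<forall>U\<in>Ts. T \<noteq> U \<longrightarrow> B T \<inter> B U = {}"
      using supp by blast
  qed
  also have "\<dots> = (\<Sum>T\<in>Ts. (n - 1) ^ i)"
  proof (rule sum.cong[OF refl])
    fix T assume T: "T \<in> Ts"
    have "card (B T) = (\<Prod>k\<in>{1..d}. if k \<in> T then n - 1 else 1)"
      unfolding B_def by (subst card_PiE) (auto intro!: prod.cong)
    also have "\<dots> = (\<Prod>k\<in>T. n - 1)"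
      using T by (subst prod.If_cases) (auto simp: Ts_def Int_absorb1)
    finally show "card (B T) = (n - 1) ^ i" using T by (simp add: Ts_def)
  qed
  also have "\<dots> = (d choose i) * (n - 1) ^ i"
    using n_subsets[of "{1..d}" i] by (simp add: Ts_def)
  finally show ?thesis .
qed

lemma neighbours_eq:
  assumes u: "u \<in> rook_states n d"
  shows "{v \<in> rook_states n d. hamming d u v = 1} =
         (\<lambda>(k, a). u(k := a)) ` (SIGMA k:{1..d}. {1..n} - {u k})"
proof (intro equalityI subsetI)
  fix v assume v: "v \<in> {v \<in> rook_states n d. hamming d u v = 1}"
  then obtain k where k: "{i\<in>{1..d}. u i \<noteq> v i} = {k}"
    by (auto simp: hamming_def card_1_singleton_iff)
  have vS: "v \<in> {1..d} \<rightarrow>\<^sub>E {1..n}" and uS: "u \<in> {1..d} \<rightarrow>\<^sub>E {1..n}"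
    using u v by (auto simp: rook_states_def)
  have kd: "k \<in> {1..d}" "u k \<noteq> v k" using eqset_imp_iff[OF k, of k] by simp_all
  have "v = u(k := v k)"
  proof
    fix i show "v i = (u(k := v k)) i"
    proof (cases "i \<in> {1..d}")
      case True then show ?thesis using eqset_imp_iff[OF k, of i] by (cases "i = k") simp_all
    next
      case False
      then show ?thesis using PiE_arb[OF vS False] PiE_arb[OF uS False] kd(1) by (metis fun_upd_other)
    qed
  qed
  moreover have "v k \<in> {1..n} - {u k}" using PiE_mem[OF vS kd(1)] kd(2) by (metis DiffI singletonD)
  ultimately show "v \<in> (\<lambda>(k, a). u(k := a)) ` (SIGMA k:{1..d}. {1..n} - {u k})"
    using kd(1) by (intro image_eqI[of _ _ "(k, v k)"]) (simp_all only: split_conv mem_Sigma_iff simp_thms)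
next
  fix v assume "v \<in> (\<lambda>(k, a). u(k := a)) ` (SIGMA k:{1..d}. {1..n} - {u k})"
  then obtain p where p: "p \<in> (SIGMA k:{1..d}. {1..n} - {u k})"
    and vp: "v = (case p of (k, a) \<Rightarrow> u(k := a))" by blast
  obtain k a where pka: "p = (k, a)" by (cases p)
  have kd: "k \<in> {1..d}" and an: "a \<in> {1..n}" and au: "a \<noteq> u k"
    using p unfolding pka by blast+
  have v: "v = u(k := a)" using vp unfolding pka split_conv .
  have "u i \<noteq> v i \<longleftrightarrow> i = k" for i
    using au unfolding v by (cases "i = k") simp_all
  then have "{i\<in>{1..d}. u i \<noteq> v i} = {k}" using kd by blast
  moreover have "v \<in> rook_states n d"
    using u kd an unfolding v rook_states_def
    by (metis fun_upd_triv insert_absorb PiE_fun_upd)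
  ultimately show "v \<in> {v \<in> rook_states n d. hamming d u v = 1}" by (simp add: hamming_def)
qed

lemma inj_on_neighbours: "inj_on (\<lambda>(k, a). u(k := a)) (SIGMA k:K. A k - {u k})"
proof (rule inj_onI)
  fix p q
  assume p: "p \<in> (SIGMA k:K. A k - {u k})" and q: "q \<in> (SIGMA k:K. A k - {u k})"
    and eq: "(case p of (k, a) \<Rightarrow> u(k := a)) = (case q of (k, a) \<Rightarrow> u(k := a))"
  obtain k a l b where [simp]: "p = (k, a)" "q = (l, b)" by (metis surj_pair)
  have upd: "u(k := a) = u(l := b)" using eq by simp
  have "a \<noteq> u k" using p by simp
  then have "k = l" using fun_cong[OF upd, of k] by (auto split: if_splits)
  then show "p = q" using fun_cong[OF upd, of k] by simp
qed

lemma hamming_ones_upd: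
  assumes "k \<in> {1..d}" "a \<noteq> u k"
  shows "hamming d (ones d) (u(k := a)) =
    (if u k = 1 then hamming d (ones d) u + 1
     else if a = 1 then hamming d (ones d) u - 1 else hamming d (ones d) u)"
proof -
  let ?T = "{i\<in>{1..d}. u i \<noteq> 1}" and ?T' = "{i\<in>{1..d}. (u(k := a)) i \<noteq> 1}"
  consider "u k = 1" | "u k \<noteq> 1" "a = 1" | "u k \<noteq> 1" "a \<noteq> 1" by blast
  then show ?thesis
  proof cases
    case 1
    then have "?T' = insert k ?T" "k \<notin> ?T" using assms by auto
    then show ?thesis using 1 by (simp add: hamming_ones)
  next
    case 2
    then have "?T' = ?T - {k}" "k \<in> ?T" using assms by auto
    then show ?thesis using 2 by (simp add: hamming_ones card_Diff_singleton)
  next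
    case 3
    then have "?T' = ?T" using assms by auto
    then show ?thesis using 3 by (simp add: hamming_ones)
  qed
qed

lemma set_eq_pairI: "(\<And>a b. (a, b) \<in> A \<longleftrightarrow> (a, b) \<in> B) \<Longrightarrow> A = B"
  by auto

lemma card_neighbours_in_shell:
  assumes u: "u \<in> shell n d i" and "n \<ge> 2"
  shows "card {v \<in> shell n d j. hamming d u v = 1} =
    (if j = i then i * (n - 2) else if j + 1 = i then i
     else if j = i + 1 then (d - i) * (n - 1) else 0)"
proof -
  have uS: "u \<in> rook_states n d" and ui: "hamming d (ones d) u = i"
    using u by (auto simp: shell_def)
  let ?T = "{k\<in>{1..d}. u k \<noteq> 1}" and ?C = "{k\<in>{1..d}. u k = 1}"
  have cT: "card ?T = i" using ui by (simp add: hamming_ones)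
  have "card ?T + card ?C = card (?T \<union> ?C)" by (rule card_Un_disjoint[symmetric]) auto
  also have "?T \<union> ?C = {1..d}" by auto
  finally have cC: "card ?C = d - i" using cT by simp
  define f where "f = (\<lambda>(k, a). u(k := a) :: nat \<Rightarrow> nat)"
  define N where "N = (SIGMA k:{1..d}. {1..n} - {u k})"
  define D where "D = {p \<in> N. hamming d (ones d) (f p) = j}"
  have inj: "inj_on f N" unfolding f_def N_def by (rule inj_on_neighbours)
  have "{v \<in> shell n d j. hamming d u v = 1} =
        {v \<in> f ` N. hamming d (ones d) v = j}"
    using neighbours_eq[OF uS] by (auto simp: shell_def f_def N_def)
  also have "\<dots> = f ` D" by (auto simp: D_def)
  also have "card \<dots> = card D"
    using inj by (intro card_image) (auto simp: D_def inj_on_def)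
  finally have card_eq: "card {v \<in> shell n d j. hamming d u v = 1} = card D" .
  have Tpos: "0 < i" if "k \<in> {1..d}" "u k \<noteq> 1" for k
    using that cT card_gt_0_iff[of ?T] by auto
  have urange: "u k \<in> {1..n}" if "k \<in> {1..d}" for k
    using uS that unfolding rook_states_def by (rule PiE_mem)
  have D_iff': "(k, a) \<in> D \<longleftrightarrow> k \<in> {1..d} \<and> a \<in> {1..n} \<and> a \<noteq> u k \<and>
      j = (if u k = 1 then i + 1 else if a = 1 then i - 1 else i)" for k a
    using hamming_ones_upd[of k d a u] ui by (auto simp: D_def N_def f_def)
  have D_iff: "(k, a) \<in> D \<longleftrightarrow> k \<in> {1..d} \<and> a \<in> {1..n} \<and> a \<noteq> u k \<and>
      (if u k = 1 then j = i + 1 else if a = 1 then j + 1 = i else j = i)" for k a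
  proof (cases "k \<in> {1..d} \<and> u k \<noteq> 1")
    case True
    then have "0 < i" using Tpos by blast
    then show ?thesis unfolding D_iff' by auto
  next
    case False
    then show ?thesis unfolding D_iff' by auto
  qed
  consider "j = i" | "j + 1 = i" | "j = i + 1" | "j \<noteq> i" "j + 1 \<noteq> i" "j \<noteq> i + 1" by blast
  then show ?thesis
  proof cases
    case 1
    have cond: "(if u k = 1 then j = i + 1 else if a = 1 then j + 1 = i else j = i)
        \<longleftrightarrow> u k \<noteq> 1 \<and> a \<noteq> 1" for k and a :: nat using 1 by simp
    have "(k, a) \<in> D \<longleftrightarrow> (k, a) \<in> (SIGMA k:?T. {1..n} - {1, u k})" for k a
      unfolding D_iff cond by blast
    then have D_eq: "D = (SIGMA k:?T. {1..n} - {1, u k})" by (rule set_eq_pairI)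
    have "card D = (\<Sum>k\<in>?T. card ({1..n} - {1, u k}))"
      unfolding D_eq by (rule card_SigmaI) simp_all
    also have "\<dots> = (\<Sum>k\<in>?T. n - 2)"
    proof (rule sum.cong[OF refl])
      fix k assume k: "k \<in> ?T"
      then have "k \<in> {1..d}" by simp
      then have "u k \<in> {1..n}" by (rule urange)
      moreover have "1 \<in> {1..n}" using \<open>n \<ge> 2\<close> by simp
      ultimately have "{1, u k} \<subseteq> {1..n}" by blast
      moreover have "card {1, u k} = 2" using k by simp
      ultimately show "card ({1..n} - {1, u k}) = n - 2" by (simp add: card_Diff_subset)
    qed
    finally show ?thesis using card_eq 1 cT by simp
  next
    case 2
    have cond: "(if u k = 1 then j = i + 1 else if a = 1 then j + 1 = i else j = i)
        \<longleftrightarrow> u k \<noteq> 1 \<and> a = 1" for k and a :: nat using 2 by auto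
    have "1 \<in> {1..n}" using \<open>n \<ge> 2\<close> by simp
    then have "(k, a) \<in> D \<longleftrightarrow> (k, a) \<in> (SIGMA k:?T. {1})" for k a
      unfolding D_iff cond by blast
    then have "D = (SIGMA k:?T. {1})" by (rule set_eq_pairI)
    then have "card D = card ?T * card {1::nat}" by (simp only: card_cartesian_product)
    then show ?thesis using card_eq 2 cT by simp
  next
    case 3
    have cond: "(if u k = 1 then j = i + 1 else if a = 1 then j + 1 = i else j = i)
        \<longleftrightarrow> u k = 1" for k and a :: nat using 3 by simp
    have "{1..n} - {1} = {2..n}" by auto
    then have "a \<in> {2..n} \<longleftrightarrow> a \<in> {1..n} \<and> a \<noteq> 1" for a by blast
    then have "(k, a) \<in> D \<longleftrightarrow> (k, a) \<in> (SIGMA k:?C. {2..n})" for k a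
      unfolding D_iff cond mem_Sigma_iff mem_Collect_eq by metis
    then have "D = (SIGMA k:?C. {2..n})" by (rule set_eq_pairI)
    then have "card D = card ?C * card {2..n}" by (simp only: card_cartesian_product)
    then show ?thesis using card_eq 3 cC by simp
  next
    case 4
    have cond: "\<not> (if u k = 1 then j = i + 1 else if a = 1 then j + 1 = i else j = i)"
      for k and a :: nat using 4 by simp
    have "(k, a) \<in> D \<longleftrightarrow> (k, a) \<in> {}" for k a
      using cond unfolding D_iff by blast
    then have "D = {}" by (rule set_eq_pairI)
    then show ?thesis using card_eq 4 by simp
  qed
qed

lemma rook_P_shell:
  assumes u: "u \<in> shell n d i" and n: "n \<ge> 2"
  shows "(\<Sum>v\<in>shell n d j. rook_P n d u v) =
    (if j = i then real i * (real n - 2) / (real d * (real n - 1))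
     else if j + 1 = i then real i / (real d * (real n - 1))
     else if j = i + 1 then (real d - real i) / real d else 0)"
proof -
  let ?c = "1 / (real d * (real n - 1))"
  have id: "i \<le> d" using u hamming_le by (auto simp: shell_def)
  have "(\<Sum>v\<in>shell n d j. rook_P n d u v) =
        (\<Sum>v | v \<in> shell n d j \<and> hamming d u v = 1. ?c)"
    unfolding rook_P_def by (rule sum.inter_filter[symmetric]) simp
  also have "\<dots> = real (card {v \<in> shell n d j. hamming d u v = 1}) * ?c" by simp
  also have "\<dots> = (if j = i then real i * (real n - 2) / (real d * (real n - 1))
     else if j + 1 = i then real i / (real d * (real n - 1))
     else if j = i + 1 then (real d - real i) / real d else 0)"
    unfolding card_neighbours_in_shell[OF u n] using n id by simp
  finally show ?thesis .
qed

lemma rwbd_P_explicit: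
  assumes "n \<ge> 2" and "i \<le> d"
  shows "rwbd_P n d i j =
    (if j = i then real i * (real n - 2) / (real d * (real n - 1))
     else if j + 1 = i then real i / (real d * (real n - 1))
     else if j = i + 1 then (real d - real i) / real d else 0)" (is "_ = ?p")
proof -
  have "(\<Sum>u\<in>shell n d i. \<Sum>v\<in>shell n d j. rook_stat n d u * rook_P n d u v) =
        (\<Sum>u\<in>shell n d i. rook_stat n d u * ?p)"
  proof (rule sum.cong[OF refl])
    fix u assume "u \<in> shell n d i"
    from rook_P_shell[OF this assms(1), of j]
    show "(\<Sum>v\<in>shell n d j. rook_stat n d u * rook_P n d u v) = rook_stat n d u * ?p"
      unfolding sum_distrib_left[symmetric] by (rule arg_cong)
  qed
  also have "\<dots> = (\<Sum>u\<in>shell n d i. rook_stat n d u) * ?p"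
    by (simp only: sum_distrib_right)
  finally have eq: "(\<Sum>u\<in>shell n d i. \<Sum>v\<in>shell n d j. rook_stat n d u * rook_P n d u v) =
    (\<Sum>u\<in>shell n d i. rook_stat n d u) * ?p" .
  have "(\<Sum>u\<in>shell n d i. rook_stat n d u) \<noteq> 0"
    using assms by (simp add: rook_stat_def card_rook_states card_shell)
  then show ?thesis unfolding rwbd_P_def eq by (rule nonzero_mult_div_cancel_left)
qed

lemma rook_P_sym: "rook_P n d x y = rook_P n d y x"
  unfolding rook_P_def by (subst hamming_commute) (rule refl)

lemma rook_P_row_sum:
  assumes "n \<ge> 2" "d \<ge> 1" "u \<in> rook_states n d"
  shows "(\<Sum>v\<in>rook_states n d. rook_P n d u v) = 1"
proof -
  have uS: "u \<in> {1..d} \<rightarrow>\<^sub>E {1..n}" using assms by (simp add: rook_states_def)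
  have "card {v \<in> rook_states n d. hamming d u v = 1} =
      card (SIGMA k:{1..d}. {1..n} - {u k})"
    unfolding neighbours_eq[OF assms(3)] by (rule card_image[OF inj_on_neighbours])
  also have "\<dots> = (\<Sum>k\<in>{1..d}. card ({1..n} - {u k}))" by (rule card_SigmaI) auto
  also have "\<dots> = (\<Sum>k\<in>{1..d}. n - 1)"
    using PiE_mem[OF uS] by (intro sum.cong refl) (auto simp: card_Diff_singleton)
  finally have "card {v \<in> rook_states n d. hamming d u v = 1} = d * (n - 1)" by simp
  moreover have "(\<Sum>v\<in>rook_states n d. rook_P n d u v) =
      (\<Sum>v | v \<in> rook_states n d \<and> hamming d u v = 1. 1 / (real d * (real n - 1)))"
    unfolding rook_P_def by (rule sum.inter_filter[symmetric]) simp
  ultimately show ?thesis using assms by (simp add: of_nat_diff)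
qed

lemma rook_stochastic:
  assumes "n \<ge> 2" "d \<ge> 1"
  shows "stochastic_on (rook_states n d) (rook_P n d)"
  using assms rook_P_row_sum by (auto simp: stochastic_on_def rook_P_def)

lemma rook_stationary:
  assumes "n \<ge> 2" "d \<ge> 1"
  shows "stationary_on (rook_states n d) (rook_P n d) (rook_stat n d)"
  unfolding stationary_on_def
proof (intro conjI ballI)
  show "(\<Sum>x\<in>rook_states n d. rook_stat n d x) = 1"
    using assms by (simp add: rook_stat_def card_rook_states)
  fix y assume y: "y \<in> rook_states n d"
  have "(\<Sum>x\<in>rook_states n d. rook_stat n d x * rook_P n d x y) =
        (\<Sum>x\<in>rook_states n d. rook_stat n d y * rook_P n d y x)"
    unfolding rook_stat_def by (intro sum.cong refl arg_cong2[of _ _ _ _ "(*)"] rook_P_sym)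
  also have "\<dots> = rook_stat n d y"
    using rook_P_row_sum[OF assms y] by (simp add: sum_distrib_left[symmetric])
  finally show "(\<Sum>x\<in>rook_states n d. rook_stat n d x * rook_P n d x y) = rook_stat n d y" .
qed (simp add: rook_stat_def)

lemma rwbd_stat_eq_shell_sum:
  assumes "n \<ge> 1"
  shows "rwbd_stat n d i = (\<Sum>u\<in>shell n d i. rook_stat n d u)"
  using assms
  by (simp add: rwbd_stat_def rook_stat_def card_shell card_rook_states of_nat_diff)

lemma rwbd_stat_mult:
  assumes "n \<ge> 2" "i \<le> d"
  shows "rwbd_stat n d i * rwbd_P n d i j =
    (\<Sum>u\<in>shell n d i. \<Sum>v\<in>shell n d j. rook_stat n d u * rook_P n d u v)"
proof -
  have "rwbd_stat n d i \<noteq> 0" using assms by (simp add: rwbd_stat_def)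
  then show ?thesis using assms by (simp add: rwbd_P_def rwbd_stat_eq_shell_sum)
qed

lemma rwbd_stochastic:
  assumes "n \<ge> 2" "d \<ge> 1"
  shows "stochastic_on (rwbd_states d) (rwbd_P n d)"
  unfolding stochastic_on_def rwbd_states_def
proof (intro ballI conjI)
  fix i j assume "i \<in> {0..d}"
  then show "0 \<le> rwbd_P n d i j" using assms by (simp add: rwbd_P_explicit)
next
  fix i assume i: "i \<in> {0..d}"
  have "card (shell n d i) \<noteq> 0" using i assms by (simp add: card_shell)
  then obtain u where u: "u \<in> shell n d i" by fastforce
  have "rwbd_P n d i j = (\<Sum>v\<in>shell n d j. rook_P n d u v)" for j
    unfolding rook_P_shell[OF u assms(1)] using i assms by (intro rwbd_P_explicit) auto
  then have "(\<Sum>j=0..d. rwbd_P n d i j) = (\<Sum>j=0..d. \<Sum>v\<in>shell n d j. rook_P n d u v)"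
    by simp
  also have "\<dots> = 1"
    unfolding sum_over_shells using u assms by (intro rook_P_row_sum) (auto simp: shell_def)
  finally show "(\<Sum>j=0..d. rwbd_P n d i j) = 1" .
qed

lemma rwbd_stationary:
  assumes "n \<ge> 2" "d \<ge> 1"
  shows "stationary_on (rwbd_states d) (rwbd_P n d) (rwbd_stat n d)"
  unfolding stationary_on_def rwbd_states_def
proof (intro ballI conjI)
  fix i show "0 \<le> rwbd_stat n d i" using assms by (simp add: rwbd_stat_def)
next
  show "(\<Sum>i=0..d. rwbd_stat n d i) = 1"
    using assms rook_stationary[OF assms]
    by (simp add: rwbd_stat_eq_shell_sum sum_over_shells stationary_on_def)
next
  fix j assume "j \<in> {0..d}"
  have "(\<Sum>i=0..d. rwbd_stat n d i * rwbd_P n d i j) =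
      (\<Sum>i=0..d. \<Sum>u\<in>shell n d i. \<Sum>v\<in>shell n d j. rook_stat n d u * rook_P n d u v)"
    using assms by (intro sum.cong refl) (simp add: rwbd_stat_mult)
  also have "\<dots> = (\<Sum>v\<in>shell n d j. \<Sum>u\<in>rook_states n d. rook_stat n d u * rook_P n d u v)"
    unfolding sum_over_shells by (rule sum.swap)
  also have "\<dots> = (\<Sum>v\<in>shell n d j. rook_stat n d v)"
    using rook_stationary[OF assms]
    by (intro sum.cong refl) (auto simp: stationary_on_def shell_def)
  also have "\<dots> = rwbd_stat n d j" using assms by (simp add: rwbd_stat_eq_shell_sum)
  finally show "(\<Sum>i=0..d. rwbd_stat n d i * rwbd_P n d i j) = rwbd_stat n d j" .
qed

end

(*
  The Hamming distance to the all-ones point lumps the Rook's Walk onto the RWBD chain, and lumping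
  never increases total variation distance.  The law started from the all-ones point is constant on
  shells: the transition matrix is symmetric, so P^t(1,v) = P^t(v,1), and {1} is itself a shell, so
  lumping gives P^t(v,1) = Q^t(i,0) for v in H_i.  Hence no distance is lost from this starting
  point.  Since the Rook's Walk is transitive, all its starting points are equally far from
  stationarity, and so, for every t, the worst starting points of both chains give the same distance,
  namely that of the RWBD chain started at 0.
*)
theory Submission
  imports Defs "HOL-Combinatorics.Transposition"
begin

section \<open>Chains on finite state spaces\<close>

text \<open>\<open>chain_law\<close> adds steps at the end of a path; reversing a path also requires
  splitting off its first step.\<close>

lemma chain_law_Suc_left:
  assumes "finite S" "x \<in> S" "y \<in> S"
  shows "chain_law S Q (Suc t) x y = (\<Sum>z\<in>S. Q x z * chain_law S Q t z y)"
  using assms(3)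
proof (induction t arbitrary: y)
  case 0
  then show ?case using assms(1,2) by (simp add: if_distrib if_distribR cong: if_cong)
next
  case (Suc t)
  have "chain_law S Q (Suc (Suc t)) x y =
      (\<Sum>w\<in>S. (\<Sum>z\<in>S. Q x z * chain_law S Q t z w) * Q w y)"
    unfolding chain_law.simps(2)[of S Q "Suc t"]
    by (intro sum.cong refl arg_cong2[where f = "(*)"] Suc.IH)
  also have "\<dots> = (\<Sum>z\<in>S. Q x z * (\<Sum>w\<in>S. chain_law S Q t z w * Q w y))"
    unfolding sum_distrib_right sum_distrib_left by (subst sum.swap) (simp add: mult.assoc)
  finally show ?case by simp
qed

text \<open>Reversing a path preserves its weight: the last step into \<open>y\<close> becomes a
  first step out of \<open>y\<close>.\<close>

lemma chain_law_sym:
  assumes "finite S" "\<And>x y. x \<in> S \<Longrightarrow> y \<in> S \<Longrightarrow> Q x y = Q y x" "x \<in> S" "y \<in> S"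
  shows "chain_law S Q t x y = chain_law S Q t y x"
  using assms(3,4)
proof (induction t arbitrary: x y)
  case (Suc t)
  have "chain_law S Q (Suc t) x y = (\<Sum>z\<in>S. Q y z * chain_law S Q t z x)"
    using Suc assms(2) by (simp add: mult.commute)
  then show ?case using Suc.prems assms(1) by (simp only: chain_law_Suc_left)
qed auto

lemma chain_law_automorphism:
  assumes \<phi>: "bij_betw \<phi> S S" and "\<And>x y. x \<in> S \<Longrightarrow> y \<in> S \<Longrightarrow> Q (\<phi> x) (\<phi> y) = Q x y"
    and "x \<in> S" "y \<in> S"
  shows "chain_law S Q t (\<phi> x) (\<phi> y) = chain_law S Q t x y"
  using assms(4)
proof (induction t arbitrary: y)
  case 0
  then show ?case using bij_betw_imp_inj_on[OF \<phi>] assms(3) by (simp add: inj_on_eq_iff)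
next
  case (Suc t)
  have "chain_law S Q (Suc t) (\<phi> x) (\<phi> y) =
      (\<Sum>z\<in>S. chain_law S Q t (\<phi> x) (\<phi> z) * Q (\<phi> z) (\<phi> y))"
    unfolding chain_law.simps by (rule sum.reindex_bij_betw[OF \<phi>, symmetric])
  then show ?case using Suc assms(2) by simp
qed

lemma tv_dist_automorphism:
  assumes "bij_betw \<phi> S S"
  shows "tv_dist S (\<lambda>x. \<mu> (\<phi> x)) (\<lambda>x. \<nu> (\<phi> x)) = tv_dist S \<mu> \<nu>"
  unfolding tv_dist_def by (simp add: sum.reindex_bij_betw[OF assms, of "\<lambda>x. \<bar>\<mu> x - \<nu> x\<bar>"])

lemma tv_dist_cong:
  assumes "\<And>x. x \<in> S \<Longrightarrow> \<mu> x = \<mu>' x" "\<And>x. x \<in> S \<Longrightarrow> \<nu> x = \<nu>' x"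
  shows "tv_dist S \<mu> \<nu> = tv_dist S \<mu>' \<nu>'"
  using assms by (simp add: tv_dist_def)

section \<open>Lumping along the fibres of a map \<open>h\<close>\<close>

text \<open>Assumption \<open>PQ\<close> is strong lumpability: the chance of entering a fibre
  depends on the current point only through its own fibre.\<close>

lemma chain_law_lump:
  assumes "finite S" "finite T" "h ` S \<subseteq> T"
    and PQ: "\<And>u j. u \<in> S \<Longrightarrow> j \<in> T \<Longrightarrow> (\<Sum>v | v \<in> S \<and> h v = j. P u v) = Q (h u) j"
    and "u \<in> S" "j \<in> T"
  shows "(\<Sum>v | v \<in> S \<and> h v = j. chain_law S P t u v) = chain_law T Q t (h u) j"
  using assms(6)
proof (induction t arbitrary: j)
  case 0
  then show ?case using assms(1,5) by auto
next
  case (Suc t)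
  have "(\<Sum>v | v \<in> S \<and> h v = j. chain_law S P (Suc t) u v) =
      (\<Sum>z\<in>S. chain_law S P t u z * (\<Sum>v | v \<in> S \<and> h v = j. P z v))"
    by (simp add: sum_distrib_left) (rule sum.swap)
  also have "\<dots> = (\<Sum>z\<in>S. chain_law S P t u z * Q (h z) j)"
    using PQ Suc.prems by simp
  \<comment> \<open>Group the penultimate point \<open>z\<close> by fibre; \<open>Q (h z) j\<close>
    is constant there and factors out.\<close>
  also have "\<dots> = (\<Sum>k\<in>T. \<Sum>z | z \<in> S \<and> h z = k. chain_law S P t u z * Q (h z) j)"
    by (rule sum.group[OF assms(1-3), symmetric])
  also have "\<dots> = (\<Sum>k\<in>T. (\<Sum>z | z \<in> S \<and> h z = k. chain_law S P t u z) * Q k j)"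
    unfolding sum_distrib_right by (intro sum.cong refl) auto
  finally show ?case using Suc.IH by simp
qed

text \<open>This is the triangle inequality inside each fibre.\<close>

lemma tv_dist_lump_le:
  assumes "finite S" "finite T" "h ` S \<subseteq> T"
  shows "tv_dist T (\<lambda>j. \<Sum>v | v \<in> S \<and> h v = j. \<mu> v) (\<lambda>j. \<Sum>v | v \<in> S \<and> h v = j. \<nu> v)
    \<le> tv_dist S \<mu> \<nu>"
  unfolding tv_dist_def sum_subtractf[symmetric]
    sum.group[OF assms, of "\<lambda>v. \<bar>\<mu> v - \<nu> v\<bar>", symmetric]
  by (intro mult_left_mono sum_mono sum_abs) simp

text \<open>The equality case: on the fibre over \<open>j\<close> the difference is the constant
  \<open>a j - b j\<close>, so nothing cancels.\<close>

lemma tv_dist_lump_eq: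
  assumes "finite S" "finite T" "h ` S \<subseteq> T"
    and "\<And>v. v \<in> S \<Longrightarrow> \<mu> v = a (h v)" "\<And>v. v \<in> S \<Longrightarrow> \<nu> v = b (h v)"
  shows "tv_dist T (\<lambda>j. \<Sum>v | v \<in> S \<and> h v = j. \<mu> v) (\<lambda>j. \<Sum>v | v \<in> S \<and> h v = j. \<nu> v)
    = tv_dist S \<mu> \<nu>"
proof -
  have "\<bar>\<Sum>v | v \<in> S \<and> h v = j. \<mu> v - \<nu> v\<bar> = (\<Sum>v | v \<in> S \<and> h v = j. \<bar>\<mu> v - \<nu> v\<bar>)" for j
  proof -
    have "(\<Sum>v | v \<in> S \<and> h v = j. \<mu> v - \<nu> v) = (\<Sum>v | v \<in> S \<and> h v = j. a j - b j)"
      using assms(4,5) by (intro sum.cong refl) auto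
    moreover have "(\<Sum>v | v \<in> S \<and> h v = j. \<bar>\<mu> v - \<nu> v\<bar>) = (\<Sum>v | v \<in> S \<and> h v = j. \<bar>a j - b j\<bar>)"
      using assms(4,5) by (intro sum.cong refl) auto
    ultimately show ?thesis by (simp add: abs_mult)
  qed
  then show ?thesis
    unfolding tv_dist_def sum_subtractf[symmetric]
      sum.group[OF assms(1-3), of "\<lambda>v. \<bar>\<mu> v - \<nu> v\<bar>", symmetric] by simp
qed

section \<open>The Rook's Walk\<close>

lemma ones_in_rook_states: "n \<ge> 1 \<Longrightarrow> ones d \<in> rook_states n d"
  by (auto simp: ones_def rook_states_def)

lemma hamming_ones_into: "(\<lambda>x. hamming d (ones d) x) ` rook_states n d \<subseteq> rwbd_states d"
  using hamming_le by (auto simp: rwbd_states_def)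

lemma finite_rwbd_states: "finite (rwbd_states d)"
  by (simp add: rwbd_states_def)

lemma shell_0:
  assumes "n \<ge> 1"
  shows "shell n d 0 = {ones d}"
proof -
  have "ones d \<in> shell n d 0"
    using ones_in_rook_states[OF assms] by (simp add: shell_def hamming_def)
  moreover obtain x where "shell n d 0 = {x}"
    using card_shell[OF assms, of d 0] by (auto simp: card_1_singleton_iff)
  ultimately show ?thesis by simp
qed

text \<open>A permutation of the symbols in each coordinate separately keeps equal entries equal and
  distinct ones distinct.\<close>

lemma rook_states_transitive:
  assumes "u \<in> rook_states n d" "v \<in> rook_states n d"
  obtains \<phi> where "bij_betw \<phi> (rook_states n d) (rook_states n d)" "\<phi> u = v"
    "\<And>x y. hamming d (\<phi> x) (\<phi> y) = hamming d x y"
proof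
  \<comment> \<open>Swap the symbols \<open>u i\<close> and \<open>v i\<close> in coordinate
    \<open>i\<close>; this is an involution, hence its own inverse on the states.\<close>
  define \<phi> where "\<phi> = (\<lambda>x. \<lambda>i\<in>{1..d}. transpose (u i) (v i) (x i))"
  have closed: "\<phi> x \<in> rook_states n d" if "x \<in> rook_states n d" for x
    using assms that unfolding rook_states_def \<phi>_def
    by (intro restrict_PiE_iff[THEN iffD2] ballI) (auto simp: transpose_def dest: PiE_mem)
  have "\<phi> (\<phi> x) = x" if "x \<in> rook_states n d" for x
  proof
    \<comment> \<open>Outside \<open>{1..d}\<close> both sides are \<open>undefined\<close>.\<close>
    fix i show "\<phi> (\<phi> x) i = x i"
      using that PiE_arb[of x "{1..d}" "\<lambda>_. {1..n}" i]
      by (cases "i \<in> {1..d}") (simp_all add: \<phi>_def rook_states_def del: atLeastAtMost_iff)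
  qed
  then show "bij_betw \<phi> (rook_states n d) (rook_states n d)"
    using closed by (intro bij_betwI[where g = \<phi>]) auto
  show "\<phi> u = v"
  proof
    fix i show "\<phi> u i = v i"
      using assms(2) PiE_arb[of v "{1..d}" "\<lambda>_. {1..n}" i]
      by (cases "i \<in> {1..d}") (simp_all add: \<phi>_def rook_states_def del: atLeastAtMost_iff)
  qed
  show "hamming d (\<phi> x) (\<phi> y) = hamming d x y" for x y
    by (auto simp: hamming_def \<phi>_def transpose_eq_iff intro!: arg_cong[of _ _ card])
qed

text \<open>An automorphism taking \<open>u\<close> to \<open>v\<close> carries one law to the other
  and fixes the uniform distribution.\<close>

lemma rook_tv_dist_start:
  assumes "u \<in> rook_states n d" "v \<in> rook_states n d"
  shows "tv_dist (rook_states n d) (chain_law (rook_states n d) (rook_P n d) t u) (rook_stat n d)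
    = tv_dist (rook_states n d) (chain_law (rook_states n d) (rook_P n d) t v) (rook_stat n d)"
    (is "tv_dist ?S (?p u) ?\<pi> = tv_dist ?S (?p v) ?\<pi>")
proof -
  obtain \<phi> where \<phi>: "bij_betw \<phi> ?S ?S" "\<phi> u = v"
    "\<And>x y. hamming d (\<phi> x) (\<phi> y) = hamming d x y"
    using rook_states_transitive[OF assms] by metis
  have "?p v (\<phi> x) = ?p u x" if "x \<in> ?S" for x
    using chain_law_automorphism[OF \<phi>(1) _ assms(1) that, of "rook_P n d" t] \<phi>(2,3)
    by (simp add: rook_P_def[abs_def])
  then have "tv_dist ?S (?p u) ?\<pi> = tv_dist ?S (\<lambda>x. ?p v (\<phi> x)) (\<lambda>x. ?\<pi> (\<phi> x))"
    by (intro tv_dist_cong) (simp_all add: rook_stat_def)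
  then show ?thesis by (simp only: tv_dist_automorphism[OF \<phi>(1)])
qed

section \<open>The RWBD chain as the lumped Rook's Walk\<close>

lemma rook_chain_law_shell:
  assumes "n \<ge> 2" "u \<in> rook_states n d" "j \<in> rwbd_states d"
  shows "(\<Sum>v\<in>shell n d j. chain_law (rook_states n d) (rook_P n d) t u v) =
    chain_law (rwbd_states d) (rwbd_P n d) t (hamming d (ones d) u) j"
  unfolding shell_def
proof (rule chain_law_lump[OF finite_rook_states finite_rwbd_states hamming_ones_into _ assms(2,3)])
  fix u j assume "u \<in> rook_states n d"
  then have "u \<in> shell n d (hamming d (ones d) u)" by (simp add: shell_def)
  then have "(\<Sum>v\<in>shell n d j. rook_P n d u v) = rwbd_P n d (hamming d (ones d) u) j"
    unfolding rwbd_P_explicit[OF assms(1) hamming_le] using assms(1) by (rule rook_P_shell)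
  then show "(\<Sum>v | v \<in> rook_states n d \<and> hamming d (ones d) v = j. rook_P n d u v) =
      rwbd_P n d (hamming d (ones d) u) j"
    by (simp only: shell_def)
qed

text \<open>The right-hand side sees \<open>v\<close> only through its shell, as the equality case
  of lumping demands.\<close>

lemma rook_chain_law_ones:
  assumes "n \<ge> 2" "v \<in> rook_states n d"
  shows "chain_law (rook_states n d) (rook_P n d) t (ones d) v =
    chain_law (rwbd_states d) (rwbd_P n d) t (hamming d (ones d) v) 0"
proof -
  have "chain_law (rook_states n d) (rook_P n d) t (ones d) v =
      chain_law (rook_states n d) (rook_P n d) t v (ones d)"
    using assms by (intro chain_law_sym rook_P_sym ones_in_rook_states) auto
  \<comment> \<open>Shell 0 is the single point \<open>ones d\<close>, so its lumped mass is a point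
    probability.\<close>
  also have "\<dots> = chain_law (rwbd_states d) (rwbd_P n d) t (hamming d (ones d) v) 0"
    using rook_chain_law_shell[OF assms, of 0 t] assms(1)
    by (simp add: shell_0 rwbd_states_def)
  finally show ?thesis .
qed

text \<open>Both arguments become shell masses, the form to which the two lumping lemmas for
  \<open>tv_dist\<close> apply.\<close>

lemma rwbd_tv_dist_eq_lumped:
  assumes "n \<ge> 2" "u \<in> rook_states n d"
  shows "tv_dist (rwbd_states d)
      (chain_law (rwbd_states d) (rwbd_P n d) t (hamming d (ones d) u)) (rwbd_stat n d) =
    tv_dist (rwbd_states d)
      (\<lambda>j. \<Sum>v\<in>shell n d j. chain_law (rook_states n d) (rook_P n d) t u v)
      (\<lambda>j. \<Sum>v\<in>shell n d j. rook_stat n d v)"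
  using assms by (intro tv_dist_cong) (simp_all add: rook_chain_law_shell rwbd_stat_eq_shell_sum)

lemma rwbd_tv_dist_le:
  assumes "n \<ge> 2" "u \<in> rook_states n d"
  shows "tv_dist (rwbd_states d)
      (chain_law (rwbd_states d) (rwbd_P n d) t (hamming d (ones d) u)) (rwbd_stat n d)
    \<le> tv_dist (rook_states n d) (chain_law (rook_states n d) (rook_P n d) t u) (rook_stat n d)"
  unfolding rwbd_tv_dist_eq_lumped[OF assms] shell_def
  by (rule tv_dist_lump_le[OF finite_rook_states finite_rwbd_states hamming_ones_into])

lemma rwbd_tv_dist_0:
  assumes "n \<ge> 2"
  shows "tv_dist (rwbd_states d) (chain_law (rwbd_states d) (rwbd_P n d) t 0) (rwbd_stat n d)
    = tv_dist (rook_states n d) (chain_law (rook_states n d) (rook_P n d) t (ones d))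
        (rook_stat n d)"
proof -
  have "ones d \<in> rook_states n d" using assms by (simp add: ones_in_rook_states)
  from rwbd_tv_dist_eq_lumped[OF assms this, of t]
  have "tv_dist (rwbd_states d) (chain_law (rwbd_states d) (rwbd_P n d) t 0) (rwbd_stat n d) =
    tv_dist (rwbd_states d)
      (\<lambda>j. \<Sum>v\<in>shell n d j. chain_law (rook_states n d) (rook_P n d) t (ones d) v)
      (\<lambda>j. \<Sum>v\<in>shell n d j. rook_stat n d v)"
    by (simp add: hamming_def)
  also have "\<dots> = tv_dist (rook_states n d)
      (chain_law (rook_states n d) (rook_P n d) t (ones d)) (rook_stat n d)"
    unfolding shell_def
    \<comment> \<open>\<open>a\<close> is the shell-constant value from
      \<open>rook_chain_law_ones\<close>, \<open>b\<close> the uniform weight of a state.\<close>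
    by (rule tv_dist_lump_eq[OF finite_rook_states finite_rwbd_states hamming_ones_into,
          where a = "\<lambda>i. chain_law (rwbd_states d) (rwbd_P n d) t i 0"
            and b = "\<lambda>_. 1 / real (card (rook_states n d))"])
      (simp_all add: rook_chain_law_ones[OF assms] rook_stat_def)
  finally show ?thesis .
qed

text \<open>Both maxima equal the distance of the Rook's Walk started at
  \<open>ones d\<close>.\<close>

lemma Max_tv_dist_eq:
  assumes "n \<ge> 2"
  shows "Max ((\<lambda>x. tv_dist (rook_states n d) (chain_law (rook_states n d) (rook_P n d) t x)
        (rook_stat n d)) ` rook_states n d) =
    Max ((\<lambda>i. tv_dist (rwbd_states d) (chain_law (rwbd_states d) (rwbd_P n d) t i)
        (rwbd_stat n d)) ` rwbd_states d)"
    (is "Max (?f ` _) = Max (?g ` _)")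
proof -
  have ones: "ones d \<in> rook_states n d" using assms by (simp add: ones_in_rook_states)
  have f: "?f x \<le> ?f (ones d)" if "x \<in> rook_states n d" for x
    using rook_tv_dist_start[OF that ones] by (rule eq_refl)
  have g: "?g i \<le> ?f (ones d)" if "i \<in> rwbd_states d" for i
  proof -
    \<comment> \<open>Every RWBD state is the image of some rook state \<open>u\<close>, whose
      distance dominates.\<close>
    have "card (shell n d i) \<noteq> 0"
      using that assms by (simp add: card_shell rwbd_states_def)
    then obtain u where u: "u \<in> shell n d i" by fastforce
    then show ?thesis
      using rwbd_tv_dist_le[OF assms, of u d t] f[of u] by (simp add: shell_def)
  qed
  have "Max (?f ` rook_states n d) = ?f (ones d)"
    using f ones by (intro Max_eqI) auto
  moreover have "Max (?g ` rwbd_states d) = ?f (ones d)"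
    \<comment> \<open>The bound \<open>g\<close> is attained at state 0.\<close>
    using g rwbd_tv_dist_0[OF assms, of d t, symmetric]
    by (intro Max_eqI) (auto simp: rwbd_states_def)
  ultimately show ?thesis by simp
qed

theorem corollary1:
  fixes n d :: nat and \<epsilon> :: real
  assumes "n \<ge> 3" and "d \<ge> 2" and "0 < \<epsilon>" and "\<epsilon> < 1"
  shows "rook_tmix n d \<epsilon> = rwbd_tmix n d \<epsilon>"
  \<comment> \<open>Equal maxima at every \<open>t\<close> make the two infima range over the same
    set of times.\<close>
  using assms by (simp add: rook_tmix_def rwbd_tmix_def mixing_time_def Max_tv_dist_eq)

end
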